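(* Let $N$ be a finite set with $|N|=n$, let $k\ge 2$ be an integer, and let $f_1,\ldots,f_k:2^N\to\mathbb{R}_+$ be monotone submodular functions with $f_i(\emptyset)=0$ for all $i\in[k]$. Then \[ \min\Big\{\sum_{i=1}^k f_i(X_i)\ \Big|\ X_1,\ldots,X_k \text{ is a partition of } N\Big\}\ \le\ \frac{k}{2}\cdot \mathrm{OPT}_{LP}, \] where $\mathrm{OPT}_{LP}$ is the optimal value of \textsc{Mono-LP-Rel} for $f_1,\ldots,f_k$. That is, the integrality gap of \textsc{Mono-LP-Rel} is at most $k/2$.
   Context: $[k]=\{1,\ldots,k\}$. A partition of $N$ into $X_1,\ldots,X_k$ allows empty parts. For $S\subseteq N$, $\chi_S\in\{0,1\}^N$ is the characteristic vector of $S$ and $\mathbf{1}$ is the all-ones vector in $\mathbb{R}^N$. A set function $f$ is submodular if $f(S)+f(T)\ge f(S\cup T)+f(S\cap T)$ for all $S,T\subseteq N$, and monotone if $f(S)\le f(T)$ whenever $S\subseteq T$. \textsc{Mono-LP-Rel} is the linear program (with monotone submodular $f_i$): minimize $\sum_{S\subseteq N,\,i\in[k]} y_i(S) f_i(S)$ subject to $y_i\in\mathbb{R}_+^{2^N}$ for every $i\in[k]$ and $\sum_{S\subseteq N,\,i\in[k]} y_i(S)\chi_S=\mathbf{1}$. Its integrality gap is the supremum, over instances, of the ratio between the minimum partition cost above and the LP optimal value. *)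

theory Defs
  imports Complex_Main "HOL-Library.Disjoint_Sets" "HOL-Library.Extended_Real"
    "HOL-Library.Indicator_Function"
begin

definition submodular_on :: "'a set \<Rightarrow> ('a set \<Rightarrow> real) \<Rightarrow> bool" where
  "submodular_on N f \<longleftrightarrow>
     (\<forall>S T. S \<subseteq> N \<longrightarrow> T \<subseteq> N \<longrightarrow> f S + f T \<ge> f (S \<union> T) + f (S \<inter> T))"

definition mono_instance :: "'a set \<Rightarrow> nat \<Rightarrow> (nat \<Rightarrow> 'a set \<Rightarrow> real) \<Rightarrow> bool" where
  "mono_instance N k f \<longleftrightarrow> finite N \<and>
     (\<forall>i\<in>{1..k}. (\<forall>S\<subseteq>N. f i S \<ge> 0) \<and> f i {} = 0 \<and>
        mono_on (Pow N) (f i) \<and> submodular_on N (f i))"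

text \<open>Parts are indexed by \<open>{1..k}\<close> and may be empty.\<close>

definition indexed_partition :: "'a set \<Rightarrow> nat \<Rightarrow> (nat \<Rightarrow> 'a set) \<Rightarrow> bool" where
  "indexed_partition N k X \<longleftrightarrow>
     (\<Union>i\<in>{1..k}. X i) = N \<and> disjoint_family_on X {1..k}"

definition partition_costs :: "'a set \<Rightarrow> nat \<Rightarrow> (nat \<Rightarrow> 'a set \<Rightarrow> real) \<Rightarrow> real set" where
  "partition_costs N k f = {(\<Sum>i=1..k. f i (X i)) | X. indexed_partition N k X}"

definition min_partition_cost :: "'a set \<Rightarrow> nat \<Rightarrow> (nat \<Rightarrow> 'a set \<Rightarrow> real) \<Rightarrow> real" where
  "min_partition_cost N k f = Min (partition_costs N k f)"

text \<open>
  Only the values \<open>y i S\<close> with \<open>i \<in> {1..k}\<close> and \<open>S \<subseteq> N\<close> are variables of the linear program.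
  The equality constraint is the vector equation in \<open>\<real>\<^sup>N\<close>, read coordinatewise, with
  \<open>indicator S\<close> as the characteristic vector of \<open>S\<close>.
\<close>

definition mono_lp_feasible :: "'a set \<Rightarrow> nat \<Rightarrow> (nat \<Rightarrow> 'a set \<Rightarrow> real) \<Rightarrow> bool" where
  "mono_lp_feasible N k y \<longleftrightarrow>
     (\<forall>i\<in>{1..k}. \<forall>S\<subseteq>N. y i S \<ge> 0) \<and>
     (\<forall>v\<in>N. (\<Sum>S\<in>Pow N. \<Sum>i=1..k. y i S * indicator S v) = 1)"

definition mono_lp_cost ::
  "'a set \<Rightarrow> nat \<Rightarrow> (nat \<Rightarrow> 'a set \<Rightarrow> real) \<Rightarrow> (nat \<Rightarrow> 'a set \<Rightarrow> real) \<Rightarrow> real" where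
  "mono_lp_cost N k f y = (\<Sum>S\<in>Pow N. \<Sum>i=1..k. y i S * f i S)"

definition mono_lp_opt :: "'a set \<Rightarrow> nat \<Rightarrow> (nat \<Rightarrow> 'a set \<Rightarrow> real) \<Rightarrow> real" where
  "mono_lp_opt N k f = Inf {mono_lp_cost N k f y | y. mono_lp_feasible N k y}"

text \<open>
  The supremum ranges over all instances with \<open>k\<close> functions whose ground set consists of elements
  of \<open>'a\<close>. It is taken in \<^typ>\<open>ereal\<close>, so an unbounded family of ratios has supremum \<open>\<infinity>\<close>; there
  \<open>0 / 0 = 0\<close>, while \<open>x / 0 = \<infinity>\<close> for \<open>x > 0\<close>.
\<close>

definition mono_lp_integrality_gap :: "'a itself \<Rightarrow> nat \<Rightarrow> ereal" where
  "mono_lp_integrality_gap _ k =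
     (SUP (N, f) \<in> {(N :: 'a set, f). mono_instance N k f}.
        ereal (min_partition_cost N k f) / ereal (mono_lp_opt N k f))"

lemma finite_partition_costs:
  assumes "finite N"
  shows "finite (partition_costs N k f)"
proof -
  have "partition_costs N k f \<subseteq>
      (\<lambda>X. \<Sum>i=1..k. f i (X i)) ` ({1..k} \<rightarrow>\<^sub>E Pow N)"
  proof
    fix c assume "c \<in> partition_costs N k f"
    then obtain X where X: "indexed_partition N k X" and c: "c = (\<Sum>i=1..k. f i (X i))"
      by (auto simp: partition_costs_def)
    have "restrict X {1..k} \<in> {1..k} \<rightarrow>\<^sub>E Pow N"
      using X by (auto simp: indexed_partition_def)
    moreover have "c = (\<Sum>i=1..k. f i (restrict X {1..k} i))"
      using c by simp
    ultimately show "c \<in> (\<lambda>X. \<Sum>i=1..k. f i (X i)) ` ({1..k} \<rightarrow>\<^sub>E Pow N)"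
      by blast
  qed
  moreover have "finite ({1..k} \<rightarrow>\<^sub>E Pow N)"
    using assms by (intro finite_PiE) auto
  ultimately show ?thesis
    by (meson finite_imageI finite_subset)
qed

lemma partition_costs_nonempty:
  assumes "k \<ge> 1"
  shows "partition_costs N k f \<noteq> {}"
proof -
  have "indexed_partition N k (\<lambda>i. if i = 1 then N else {})"
    using assms by (auto simp: indexed_partition_def disjoint_family_on_def)
  then show ?thesis
    by (auto simp: partition_costs_def)
qed

lemma mono_lp_feasible_nonempty:
  assumes "finite N" "k \<ge> 1"
  shows "\<exists>y. mono_lp_feasible N k y"
proof
  let ?y = "\<lambda>i S. if S = N then (if i = 1 then 1 else 0) else 0 :: real"
  have "(\<Sum>S\<in>Pow N. \<Sum>i=1..k. ?y i S * indicator S v) = 1" if "v \<in> N" for v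
  proof -
    have "(\<Sum>S\<in>Pow N. \<Sum>i=1..k. ?y i S * indicator S v) =
        (\<Sum>S\<in>Pow N. if S = N then 1 else 0)"
    proof (intro sum.cong refl)
      fix S
      have "(\<Sum>i=1..k. ?y i S * indicator S v) =
          (\<Sum>i=1..k. if i = 1 then (if S = N then 1 else 0) else 0)"
        using that by (intro sum.cong) auto
      also have "\<dots> = (if S = N then 1 else 0)"
        using assms by simp
      finally show "(\<Sum>i=1..k. ?y i S * indicator S v) = (if S = N then 1 else 0)" .
    qed
    also have "\<dots> = 1"
      using assms by simp
    finally show ?thesis .
  qed
  then show "mono_lp_feasible N k ?y"
    by (auto simp: mono_lp_feasible_def)
qed

lemma mono_lp_cost_nonneg:
  assumes "mono_instance N k f" "mono_lp_feasible N k y"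
  shows "mono_lp_cost N k f y \<ge> 0"
  using assms unfolding mono_lp_cost_def mono_instance_def mono_lp_feasible_def
  by (intro sum_nonneg mult_nonneg_nonneg) auto

end

theory Submission
  imports Defs "HOL-Analysis.Henstock_Kurzweil_Integration"
begin

text \<open>
  Let \<open>z\<^sub>i = \<Sum>\<^sub>S y\<^sub>i(S) \<chi>\<^sub>S\<close> for a feasible \<open>y\<close>. Since \<open>\<Sum>\<^sub>i z\<^sub>i = 1\<close>, the level sets
  \<open>{v. k/2 \<cdot> z\<^sub>i(v) \<ge> \<theta>\<^sub>i}\<close> cover \<open>N\<close> whenever \<open>\<Sum>\<^sub>i \<theta>\<^sub>i = k/2\<close>, and by monotonicity a cover can be
  shrunk to a partition. For \<open>k \<ge> 2\<close> there are \<open>k\<close> random variables \<open>\<theta>\<^sub>i\<close>, each uniform on \<open>[0,1]\<close>,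
  whose sum is constantly \<open>k/2\<close>: combine antithetic pairs \<open>(u, 1 - u)\<close> and, for odd \<open>k\<close>, one triple.
  The expected cost of \<open>i\<close> is then at most \<open>k/2\<close> times the Lovasz extension of \<open>f\<^sub>i\<close> at \<open>z\<^sub>i\<close>, which
  Edmonds' greedy weights bound by \<open>\<Sum>\<^sub>S y\<^sub>i(S) f\<^sub>i(S)\<close>.
\<close>

section \<open>Greedy weights for a monotone submodular function\<close>

lemma submodular_on_subset:
  "submodular_on N f \<Longrightarrow> M \<subseteq> N \<Longrightarrow> submodular_on M f"
  unfolding submodular_on_def by blast

text \<open>Add the elements in order of decreasing \<open>x\<close> and give each its marginal
  value. Superlevel sets of \<open>x\<close> are prefixes of this order, so their weights telescope
  to \<open>f\<close>; submodularity keeps every other set below \<open>f\<close>, and monotonicity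
  makes the marginals nonnegative.\<close>

lemma greedy_weights:
  fixes x :: "'a \<Rightarrow> real"
  assumes "finite N" "mono_on (Pow N) f" "submodular_on N f" "f {} = 0"
  shows "\<exists>w. (\<forall>v\<in>N. 0 \<le> w v) \<and> (\<forall>S\<subseteq>N. sum w S \<le> f S) \<and> sum w N = f N \<and>
    (\<forall>t. sum w {v\<in>N. t \<le> x v} = f {v\<in>N. t \<le> x v})"
  using assms
proof (induction N rule: finite_ranking_induct[where f = "\<lambda>v. - x v"])
  case empty
  then show ?case by auto
next
  case (insert v M)
  show ?case
  \<comment> \<open>The ranking induction may insert an element already present.\<close>
  proof (cases "v \<in> M")
    case True
    then show ?thesis
      using insert by (simp add: insert_absorb)
  next
    case False
    have "mono_on (Pow M) f" "submodular_on M f"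
      using insert.prems by (auto intro: mono_on_subset submodular_on_subset)
    then obtain w where w: "\<forall>u\<in>M. 0 \<le> w u" "\<forall>S\<subseteq>M. sum w S \<le> f S" "sum w M = f M"
        "\<And>t. sum w {u\<in>M. t \<le> x u} = f {u\<in>M. t \<le> x u}"
      using insert.IH insert.prems by blast
    define w' where "w' = w(v := f (insert v M) - f M)"
    have w'_old: "sum w' S = sum w S" if "v \<notin> S" for S
      using that by (intro sum.cong) (auto simp: w'_def)
    have w'_new: "sum w' (insert v S) = sum w S + f (insert v M) - f M" if "S \<subseteq> M" for S
    proof -
      have "finite S" "v \<notin> S"
        using that False insert.hyps finite_subset by auto
      then show ?thesis
        using w'_old by (simp add: w'_def)
    qed
    have "f M \<le> f (insert v M)"
      by (rule mono_onD[OF insert.prems(1)]) auto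
    then have "\<forall>u\<in>insert v M. 0 \<le> w' u"
      using w(1) by (auto simp: w'_def)
    moreover have "sum w' S \<le> f S" if S: "S \<subseteq> insert v M" for S
    proof (cases "v \<in> S")
      case True
      \<comment> \<open>Diminishing returns: the marginal of \<open>v\<close> over
        \<open>S - {v}\<close> is at least its marginal over \<open>M\<close>.\<close>
      have "f (S \<union> M) + f (S \<inter> M) \<le> f S + f M"
        using insert.prems(2) S by (auto simp: submodular_on_def)
      moreover have "S \<union> M = insert v M" "S \<inter> M = S - {v}" "insert v (S - {v}) = S"
        using S True False by auto
      moreover have "sum w (S - {v}) \<le> f (S - {v})"
        using w(2) S True by (simp add: subset_insert_iff)
      ultimately show ?thesis
        using w'_new[of "S - {v}"] S True by (simp add: subset_insert_iff)
    next
      case False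
      then show ?thesis
        using w(2) S by (simp add: w'_old subset_insert)
    qed
    moreover have total: "sum w' (insert v M) = f (insert v M)"
      using w'_new[of M] w(3) by simp
    moreover have "sum w' {u\<in>insert v M. t \<le> x u} = f {u\<in>insert v M. t \<le> x u}" for t
    proof (cases "t \<le> x v")
      case True
      \<comment> \<open>\<open>v\<close> has the least \<open>x\<close>-value so far, so once it
        reaches the level \<open>t\<close>, all of \<open>M\<close> does.\<close>
      then have "{u\<in>insert v M. t \<le> x u} = insert v M"
        using insert.hyps by force
      then show ?thesis
        using total by simp
    next
      case False
      then have "{u\<in>insert v M. t \<le> x u} = {u\<in>M. t \<le> x u}"
        by auto
      then show ?thesis
        using w(4) \<open>v \<notin> M\<close> by (simp add: w'_old)
    qed
    ultimately show ?thesis by blast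
  qed
qed

section \<open>Level sets and the Lovasz extension\<close>

lemma has_integral_threshold:
  fixes x :: real
  assumes "0 \<le> x"
  shows "((\<lambda>u. of_bool (u \<le> x)) has_integral min 1 x) {0..1}"
proof -
  have "((\<lambda>u. 1 :: real) has_integral min 1 x) {0..min 1 x}"
    using has_integral_const_real[of "1::real" 0 "min 1 x"] assms by simp
  then have "((\<lambda>u. if u \<in> {0..min 1 x} then 1 else 0 :: real) has_integral min 1 x) {0..1}"
    by (subst has_integral_restrict) auto
  then show ?thesis
    by (rule has_integral_eq[rotated]) auto
qed

text \<open>On superlevel sets \<open>f\<close> agrees with one additive weight \<open>w\<close>, so
  the integral is linear in \<open>w\<close>; exchanging sums and using
  \<open>sum w S \<le> f S\<close> for each \<open>S\<close> gives the bound.\<close>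

lemma lovasz_extension_le:
  fixes x :: "'a \<Rightarrow> real"
  assumes N: "finite N" and f: "mono_on (Pow N) f" "submodular_on N f" "f {} = 0"
    and y: "\<And>S. S \<subseteq> N \<Longrightarrow> 0 \<le> y S"
    and x: "\<And>v. v \<in> N \<Longrightarrow> x v = c * (\<Sum>S\<in>Pow N. y S * indicator S v)" and c: "0 \<le> c"
  shows "(\<lambda>u. f {v\<in>N. u \<le> x v}) integrable_on {0..1}" (is "?int")
    and "integral {0..1} (\<lambda>u. f {v\<in>N. u \<le> x v}) \<le> c * (\<Sum>S\<in>Pow N. y S * f S)" (is "?le")
proof -
  obtain w where w: "\<forall>v\<in>N. 0 \<le> w v" "\<forall>S\<subseteq>N. sum w S \<le> f S"
      "\<And>t. sum w {v\<in>N. t \<le> x v} = f {v\<in>N. t \<le> x v}"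
    using greedy_weights[OF N f, of x] by blast
  have x0: "0 \<le> x v" if "v \<in> N" for v
    using x[OF that] y c by (auto intro!: mult_nonneg_nonneg sum_nonneg)
  have "((\<lambda>u. \<Sum>v\<in>N. w v * of_bool (u \<le> x v)) has_integral (\<Sum>v\<in>N. w v * min 1 (x v))) {0..1}"
    using N x0 by (intro has_integral_sum has_integral_mult_right has_integral_threshold)
  moreover have "(\<Sum>v\<in>N. w v * of_bool (u \<le> x v)) = f {v\<in>N. u \<le> x v}" for u
    using N by (simp flip: w(3) add: of_bool_def if_distrib sum.If_cases Int_def cong: if_cong)
  moreover have "(\<Sum>v\<in>N. w v * min 1 (x v)) \<le> c * (\<Sum>S\<in>Pow N. y S * f S)"
  proof -
    \<comment> \<open>Thresholds stop at 1 while \<open>x\<close> may exceed 1; nonnegative weights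
      allow the truncation to be dropped.\<close>
    have "(\<Sum>v\<in>N. w v * min 1 (x v)) \<le> (\<Sum>v\<in>N. w v * x v)"
      using w(1) by (intro sum_mono mult_left_mono) auto
    also have "\<dots> = c * (\<Sum>v\<in>N. \<Sum>S\<in>Pow N. y S * (w v * indicator S v))"
      by (simp add: x sum_distrib_left mult_ac cong: sum.cong)
    also have "\<dots> = c * (\<Sum>S\<in>Pow N. y S * (\<Sum>v\<in>N. w v * indicator S v))"
      by (subst sum.swap) (simp add: sum_distrib_left)
    also have "\<dots> = c * (\<Sum>S\<in>Pow N. y S * sum w S)"
    proof -
      have "(\<Sum>v\<in>N. w v * indicator S v) = sum w S" if "S \<in> Pow N" for S
        using that N by (simp add: indicator_def if_distrib sum.If_cases Int_absorb1 cong: if_cong)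
      then show ?thesis by simp
    qed
    also have "\<dots> \<le> c * (\<Sum>S\<in>Pow N. y S * f S)"
      using w(2) y c by (intro mult_left_mono sum_mono) auto
    finally show ?thesis .
  qed
  ultimately show ?int ?le
    by (auto simp: has_integral_iff)
qed

section \<open>Coupled uniform thresholds with constant sum\<close>

lemma has_integral_affine_real:
  fixes g :: "real \<Rightarrow> real"
  assumes "(g has_integral I) {a..b}" "a \<le> b" "m \<noteq> 0"
  shows "((\<lambda>u. g (m * u + c)) has_integral I / \<bar>m\<bar>)
    (if 0 < m then {(a - c) / m..(b - c) / m} else {(b - c) / m..(a - c) / m})"
proof -
  have "(\<lambda>u. 1 / m * u + - (1 / m * c)) ` {a..b} =
      (if 0 < m then {(a - c) / m..(b - c) / m} else {(b - c) / m..(a - c) / m})"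
    using assms(2,3) by (subst image_affinity_atLeastAtMost) (auto simp: diff_divide_distrib)
  then show ?thesis
    using has_integral_affinity[of g I a b m c] assms by simp
qed

text \<open>If \<open>u\<close> is uniform on [0,1], so is \<open>1 - u\<close>; average the
  pointwise bound.\<close>

lemma average_pair:
  fixes g h :: "real \<Rightarrow> real"
  assumes g: "(g has_integral I) {0..1}" and h: "(h has_integral J) {0..1}"
    and le: "\<And>u. u \<in> {0..1} \<Longrightarrow> c \<le> g u + h (1 - u)"
  shows "c \<le> I + J"
proof -
  have "((\<lambda>u. h (- 1 * u + 1)) has_integral J) {0..1}"
    using has_integral_affine_real[OF h, of "-1" 1] by simp
  then have "((\<lambda>u. g u + h (1 - u)) has_integral I + J) {0..1}"
    using has_integral_add[OF g] by simp
  moreover have "((\<lambda>_. c) has_integral c) {0..1::real}"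
    using has_integral_const_real[of c 0 1] by simp
  ultimately show ?thesis
    using le by (blast intro: has_integral_le)
qed

text \<open>Take \<open>u\<close> uniform on [0,1/2] and choose
  \<open>(u, u + 1/2, 1 - 2 * u)\<close> or the same triple with its first two entries swapped, each
  with probability 1/2. Every entry is uniform on [0,1] and the sum is always 3/2.\<close>

lemma average_triple:
  fixes g h l :: "real \<Rightarrow> real"
  assumes g: "(g has_integral I) {0..1}" and h: "(h has_integral J) {0..1}"
    and l: "(l has_integral K) {0..1}"
    and le: "\<And>r s t. r \<in> {0..1} \<Longrightarrow> s \<in> {0..1} \<Longrightarrow> t \<in> {0..1} \<Longrightarrow> r + s + t = 3 / 2 \<Longrightarrow>
      c \<le> g r + h s + l t"
  shows "c \<le> I + J + K"
proof -
  have halves: "((\<lambda>u. p u + p (u + 1 / 2)) has_integral P) {0..1/2}"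
    if p: "(p has_integral P) {0..1}" for p :: "real \<Rightarrow> real" and P
  proof -
    have "p integrable_on {0..1/2}" "p integrable_on {1/2..1}"
      using p by (auto intro: integrable_on_subinterval)
    then obtain P1 P2 where P: "(p has_integral P1) {0..1/2}" "(p has_integral P2) {1/2..1}"
      by (auto simp: integrable_on_def)
    then have "P1 + P2 = P"
      using has_integral_combine[of 0 "1/2" 1 p P1 P2] has_integral_unique[OF p] by auto
    moreover have "((\<lambda>u. p (u + 1 / 2)) has_integral P2) {0..1/2}"
      using has_integral_affine_real[OF P(2), of 1 "1/2"] by simp
    ultimately show ?thesis
      using has_integral_add[OF P(1)] by blast
  qed
  \<comment> \<open>The slope -2 halves the integral; the factor 2 below restores it, since both
    orders of the triple share this third entry.\<close>
  have "((\<lambda>u. l (- 2 * u + 1)) has_integral K / 2) {0..1/2}"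
    using has_integral_affine_real[OF l, of "-2" 1] by simp
  then have "((\<lambda>u. 2 * l (1 - 2 * u)) has_integral K) {0..1/2}"
    using has_integral_mult_right[of "\<lambda>u. l (1 - 2 * u)" "K / 2" _ 2] by simp
  then have "((\<lambda>u. (g u + g (u + 1/2)) + (h u + h (u + 1/2)) + 2 * l (1 - 2 * u))
      has_integral I + J + K) {0..1/2}"
    by (intro has_integral_add halves g h)
  moreover have "((\<lambda>_. 2 * c) has_integral c) {0..1/2::real}"
    using has_integral_const_real[of "2 * c" 0 "1/2"] by simp
  moreover have "2 * c \<le> (g u + g (u + 1/2)) + (h u + h (u + 1/2)) + 2 * l (1 - 2 * u)"
    if "u \<in> {0..1/2}" for u
    using le[of u "u + 1/2" "1 - 2 * u"] le[of "u + 1/2" u "1 - 2 * u"] that by auto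
  ultimately show ?thesis
    by (blast intro: has_integral_le)
qed

text \<open>Antithetic pairs are peeled off until nothing or a triple remains. The bound
  \<open>c\<close> is generalized in the induction because each peeled pair shifts it by
  \<open>I a + I b\<close>. A single threshold would be forced to equal 1/2, hence
  \<open>card A \<noteq> 1\<close>.\<close>

lemma average_thresholds:
  fixes g :: "'i \<Rightarrow> real \<Rightarrow> real"
  assumes "finite A" "card A \<noteq> 1"
    and "\<And>i. i \<in> A \<Longrightarrow> (g i has_integral I i) {0..1}"
    and "\<And>\<theta>. (\<And>i. i \<in> A \<Longrightarrow> \<theta> i \<in> {0..1}) \<Longrightarrow> sum \<theta> A = card A / 2 \<Longrightarrow>
      c \<le> (\<Sum>i\<in>A. g i (\<theta> i))"
  shows "c \<le> sum I A"
  using assms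
proof (induction "card A" arbitrary: A c rule: less_induct)
  case less
  note g = less.prems(3) and le = less.prems(4)
  \<comment> \<open>Removing a pair from three indices would leave the excluded size 1.\<close>
  consider "card A = 0" | "card A = 3" | "card A = 2 \<or> card A \<ge> 4"
    using less.prems(2) by linarith
  then show ?case
  proof cases
    case 1
    then show ?thesis
      using less.prems(1) le[of "\<lambda>_. 0"] by simp
  next
    case 2
    then obtain a b d where A: "A = {a, b, d}" "a \<noteq> b" "b \<noteq> d" "a \<noteq> d"
      by (auto simp: card_3_iff)
    have "c \<le> g a r + g b s + g d t"
      if "r \<in> {0..1}" "s \<in> {0..1}" "t \<in> {0..1}" "r + s + t = 3 / 2" for r s t
    proof -
      let ?\<theta> = "\<lambda>i. if i = a then r else if i = b then s else t"
      have "c \<le> (\<Sum>i\<in>A. g i (?\<theta> i))"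
        using that A by (intro le) auto
      then show ?thesis
        using A by (simp add: add_ac)
    qed
    then have "c \<le> I a + I b + I d"
      using A by (intro average_triple[OF g g g]) auto
    then show ?thesis
      using A by simp
  next
    case 3
    then have "2 \<le> card A" by auto
    then obtain T where "T \<subseteq> A" "card T = 2"
      by (metis obtain_subset_with_card_n)
    then obtain a b where ab: "a \<in> A" "b \<in> A" "a \<noteq> b"
      by (auto simp: card_2_iff)
    define B where "B = A - {a, b}"
    have A: "A = insert a (insert b B)" and B: "a \<notin> B" "b \<notin> B" "finite B"
      using ab less.prems(1) by (auto simp: B_def)
    have card: "card A = card B + 2"
      using A B ab by simp
    have "c - (I a + I b) \<le> sum I B"
    proof (rule less.hyps)
      fix \<theta> assume \<theta>: "\<And>i. i \<in> B \<Longrightarrow> \<theta> i \<in> {0..1}" "sum \<theta> B = card B / 2"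
      \<comment> \<open>With \<theta> fixed on \<open>B\<close>, the pair \<open>u\<close>,
        \<open>1 - u\<close> adds exactly 1 to the sum, as \<open>card A / 2\<close>
        requires.\<close>
      have "c - (\<Sum>i\<in>B. g i (\<theta> i)) \<le> g a u + g b (1 - u)" if u: "u \<in> {0..1}" for u
      proof -
        let ?\<theta> = "\<theta>(a := u, b := 1 - u)"
        have upd: "(\<Sum>i\<in>B. F i (?\<theta> i)) = (\<Sum>i\<in>B. F i (\<theta> i))" for F :: "'i \<Rightarrow> real \<Rightarrow> real"
          using B by (intro sum.cong) auto
        have "c \<le> (\<Sum>i\<in>A. g i (?\<theta> i))"
        proof (rule le)
          show "?\<theta> i \<in> {0..1}" if "i \<in> A" for i
            using that u \<theta>(1) A by auto
          show "sum ?\<theta> A = card A / 2"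
            using upd[of "\<lambda>_ t. t"] \<theta>(2) card A B ab by (simp add: field_simps)
        qed
        then show ?thesis
          using upd[of g] A B ab by simp
      qed
      then have "c - (\<Sum>i\<in>B. g i (\<theta> i)) \<le> I a + I b"
        using ab by (intro average_pair[OF g g]) auto
      then show "c - (I a + I b) \<le> (\<Sum>i\<in>B. g i (\<theta> i))"
        by simp
    qed (use A B g card 3 in auto)
    then show ?thesis
      using A B ab by simp
  qed
qed

section \<open>Rounding a fractional solution\<close>

lemma min_partition_cost_le_cover:
  assumes "mono_instance N k f"
    and L: "\<And>i. i \<in> {1..k} \<Longrightarrow> L i \<subseteq> N" "N \<subseteq> (\<Union>i\<in>{1..k}. L i)"
  shows "min_partition_cost N k f \<le> (\<Sum>i=1..k. f i (L i))"
proof -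
  have N: "finite N" and f: "\<And>i. i \<in> {1..k} \<Longrightarrow> mono_on (Pow N) (f i)"
    using assms(1) by (auto simp: mono_instance_def)
  \<comment> \<open>Each element goes to the first set of the cover that contains it.\<close>
  define X where "X i = L i - (\<Union>j\<in>{1..<i}. L j)" for i
  have "v \<in> (\<Union>i\<in>{1..k}. X i)" if v: "v \<in> N" for v
  proof -
    obtain j where j: "j \<in> {1..k}" "v \<in> L j"
      using L(2) v by auto
    define i where "i = (LEAST i. i \<in> {1..k} \<and> v \<in> L i)"
    have "i \<in> {1..k} \<and> v \<in> L i"
      using LeastI[of "\<lambda>i. i \<in> {1..k} \<and> v \<in> L i" j] j unfolding i_def by blast
    moreover have "v \<notin> L m" if "m \<in> {1..<i}" for m
      using not_less_Least[of m "\<lambda>i. i \<in> {1..k} \<and> v \<in> L i", folded i_def] that calculation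
      by auto
    ultimately show ?thesis
      by (auto simp: X_def)
  qed
  moreover have "X i \<subseteq> N" if "i \<in> {1..k}" for i
    using L(1)[OF that] by (auto simp: X_def)
  moreover have "X i \<inter> X j = {}" if "i \<in> {1..k}" "j \<in> {1..k}" "i \<noteq> j" for i j
    using that by (cases i j rule: linorder_cases) (auto simp: X_def)
  ultimately have "indexed_partition N k X"
    unfolding indexed_partition_def disjoint_family_on_def by blast
  then have "min_partition_cost N k f \<le> (\<Sum>i=1..k. f i (X i))"
    unfolding min_partition_cost_def
    by (intro Min_le finite_partition_costs N) (auto simp: partition_costs_def)
  also have "\<dots> \<le> (\<Sum>i=1..k. f i (L i))"
  proof (intro sum_mono)
    fix i assume i: "i \<in> {1..k}"
    show "f i (X i) \<le> f i (L i)"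
      using L(1)[OF i] by (intro mono_onD[OF f[OF i]]) (auto simp: X_def)
  qed
  finally show ?thesis .
qed

lemma min_partition_cost_le_lp_cost:
  assumes inst: "mono_instance N k f" and k: "2 \<le> k" and y: "mono_lp_feasible N k y"
  shows "min_partition_cost N k f \<le> real k / 2 * mono_lp_cost N k f y"
proof -
  \<comment> \<open>The scaling makes the values at each \<open>v\<close> sum to
    \<open>k / 2\<close>, the sum of the thresholds.\<close>
  define x where "x i v = real k / 2 * (\<Sum>S\<in>Pow N. y i S * indicator S v)" for i v
  define g where "g = (\<lambda>i u. f i {v\<in>N. u \<le> x i v})"
  have g: "g i integrable_on {0..1}"
      "integral {0..1} (g i) \<le> real k / 2 * (\<Sum>S\<in>Pow N. y i S * f i S)" if "i \<in> {1..k}" for i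
    unfolding g_def using inst y that
    by (intro lovasz_extension_le[where y = "y i" and c = "real k / 2"]; simp add: mono_instance_def mono_lp_feasible_def x_def)+
  have sum_x: "(\<Sum>i=1..k. x i v) = real k / 2" if "v \<in> N" for v
  proof -
    have "(\<Sum>i=1..k. x i v) = real k / 2 * (\<Sum>S\<in>Pow N. \<Sum>i=1..k. y i S * indicator S v)"
      unfolding x_def by (subst sum.swap) (simp add: sum_distrib_left)
    then show ?thesis
      using y that by (simp add: mono_lp_feasible_def)
  qed
  have "min_partition_cost N k f \<le> (\<Sum>i=1..k. integral {0..1} (g i))"
  proof (rule average_thresholds)
    fix \<theta> :: "nat \<Rightarrow> real" assume "sum \<theta> {1..k} = card {1..k} / 2"
    then have \<theta>: "sum \<theta> {1..k} = real k / 2" by simp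
    show "min_partition_cost N k f \<le> (\<Sum>i=1..k. g i (\<theta> i))"
      unfolding g_def
    proof (rule min_partition_cost_le_cover[OF inst])
      \<comment> \<open>Both families sum to \<open>k / 2\<close>, so the thresholds cannot all be
        strictly larger.\<close>
      have "\<exists>i\<in>{1..k}. \<theta> i \<le> x i v" if "v \<in> N" for v
      proof (rule ccontr)
        assume "\<not> (\<exists>i\<in>{1..k}. \<theta> i \<le> x i v)"
        then have "(\<Sum>i=1..k. x i v) < sum \<theta> {1..k}"
          using k by (intro sum_strict_mono) (auto simp: not_le)
        then show False
          using sum_x[OF that] \<theta> by simp
      qed
      then show "N \<subseteq> (\<Union>i\<in>{1..k}. {v\<in>N. \<theta> i \<le> x i v})"
        by auto
    qed auto
  qed (use k g(1) in \<open>auto simp: integrable_integral\<close>)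
  also have "\<dots> \<le> (\<Sum>i=1..k. real k / 2 * (\<Sum>S\<in>Pow N. y i S * f i S))"
    by (intro sum_mono g(2))
  also have "\<dots> = real k / 2 * mono_lp_cost N k f y"
    unfolding mono_lp_cost_def by (subst sum.swap) (simp add: sum_distrib_left)
  finally show ?thesis .
qed

lemma min_partition_cost_le_lp_opt:
  assumes inst: "mono_instance N k f" and k: "2 \<le> k"
  shows "min_partition_cost N k f \<le> real k / 2 * mono_lp_opt N k f"
proof -
  have "2 / real k * min_partition_cost N k f \<le> mono_lp_opt N k f"
    unfolding mono_lp_opt_def
  proof (rule cInf_greatest)
    show "{mono_lp_cost N k f y | y. mono_lp_feasible N k y} \<noteq> {}"
      using mono_lp_feasible_nonempty[of N k] inst k by (auto simp: mono_instance_def)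
  next
    fix c assume "c \<in> {mono_lp_cost N k f y | y. mono_lp_feasible N k y}"
    then have "min_partition_cost N k f \<le> real k / 2 * c"
      using min_partition_cost_le_lp_cost[OF inst k] by auto
    then show "2 / real k * min_partition_cost N k f \<le> c"
      using k by (simp add: field_simps)
  qed
  then show ?thesis
    using k by (simp add: field_simps)
qed

section \<open>From the cost bound to the integrality gap\<close>

lemma mono_lp_opt_nonneg:
  assumes "mono_instance N k f" "1 \<le> k"
  shows "0 \<le> mono_lp_opt N k f"
  unfolding mono_lp_opt_def
  using assms mono_lp_feasible_nonempty[of N k] mono_lp_cost_nonneg[OF assms(1)]
  by (intro cInf_greatest) (auto simp: mono_instance_def)

lemma min_partition_cost_nonneg:
  assumes "mono_instance N k f" "1 \<le> k"
  shows "0 \<le> min_partition_cost N k f"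
proof -
  have "min_partition_cost N k f \<in> partition_costs N k f"
    unfolding min_partition_cost_def using assms
    by (intro Min_in finite_partition_costs partition_costs_nonempty) (auto simp: mono_instance_def)
  then obtain X where X: "indexed_partition N k X" "min_partition_cost N k f = (\<Sum>i=1..k. f i (X i))"
    by (auto simp: partition_costs_def)
  have "0 \<le> f i (X i)" if "i \<in> {1..k}" for i
    using assms(1) X(1) that unfolding mono_instance_def indexed_partition_def by blast
  then show ?thesis
    unfolding X(2) by (intro sum_nonneg) auto
qed

theorem theorem1:
  fixes N :: "'a set" and k :: nat and f :: "nat \<Rightarrow> 'a set \<Rightarrow> real"
  assumes "finite N"
    and "k \<ge> 2"
    and "\<And>i S. i \<in> {1..k} \<Longrightarrow> S \<subseteq> N \<Longrightarrow> f i S \<ge> 0"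
    and "\<And>i. i \<in> {1..k} \<Longrightarrow> mono_on (Pow N) (f i)"
    and "\<And>i. i \<in> {1..k} \<Longrightarrow> submodular_on N (f i)"
    and "\<And>i. i \<in> {1..k} \<Longrightarrow> f i {} = 0"
  shows "min_partition_cost N k f \<le> real k / 2 * mono_lp_opt N k f \<and>
    mono_lp_integrality_gap TYPE('a) k \<le> ereal (real k / 2)"
proof
  have "mono_instance N k f"
    using assms by (auto simp: mono_instance_def)
  then show "min_partition_cost N k f \<le> real k / 2 * mono_lp_opt N k f"
    using assms(2) by (rule min_partition_cost_le_lp_opt)
next
  have "ereal (min_partition_cost M k g) / ereal (mono_lp_opt M k g) \<le> ereal (real k / 2)"
    if inst: "mono_instance M k g" for M :: "'a set" and g
  proof -
    have le: "min_partition_cost M k g \<le> real k / 2 * mono_lp_opt M k g"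
      using inst assms(2) by (rule min_partition_cost_le_lp_opt)
    have nonneg: "0 \<le> mono_lp_opt M k g" "0 \<le> min_partition_cost M k g"
      using inst assms(2) by (auto intro: mono_lp_opt_nonneg min_partition_cost_nonneg)
    show ?thesis
    \<comment> \<open>A zero LP value forces zero partition cost, so the ratio is 0 / 0 = 0 and
      never \<infinity>.\<close>
    proof (cases "mono_lp_opt M k g = 0")
      case True
      then have "min_partition_cost M k g = 0"
        using le nonneg by simp
      then show ?thesis by simp
    next
      case False
      then show ?thesis
        using le nonneg by (simp add: divide_le_eq)
    qed
  qed
  then show "mono_lp_integrality_gap TYPE('a) k \<le> ereal (real k / 2)"
    unfolding mono_lp_integrality_gap_def by (intro SUP_least) auto
qed

end
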